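(* Assume the standing assumption, the strong pseudomonotonicity assumption, the state-Lipschitz assumption on $h$, the time regularity assumption and the Lipschitz assumption on $f$ stated in the context. Let $L:=\alpha_h\|P^{-1}\|/\gamma$ and $\tilde L:=\alpha_f+\beta_fL$. Assume further that the linear semigroup is exponentially decaying, namely that for some $M\ge1$ and some $\eta>M\tilde L$, $$\|e^{At}\|\le Me^{-\eta t}\quad\text{for all } t\ge0.$$ Then for any two mild solution pairs $(x_i,u_i)$ with initial states $x_{0,i}\in H$, $i=1,2$, we have for all $t\in[0,T]$ $$\|x_1(t)-x_2(t)\|\le Me^{-(\eta-M\tilde L)t}\|x_{0,1}-x_{0,2}\|,\qquad \|u_1(t)-u_2(t)\|\le LMe^{-(\eta-M\tilde L)t}\|x_{0,1}-x_{0,2}\|.$$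
   Context: Let $H$ be a separable real Hilbert space with inner product $\langle\cdot,\cdot\rangle$ and norm $\|\cdot\|$, $\mathbb B_R(0)$ its closed ball of radius $R$ centered at $0$, and $T>0$. For nonempty closed convex $C\subset H$, $\mathrm{proj}_C$ is the metric projection onto $C$, and $N_C(y)=\{\xi\in H:\langle\xi,v-y\rangle\le0\ \forall v\in C\}$ if $y\in C$, $N_C(y)=\emptyset$ otherwise. A mapping $G:[0,T]\times X\to H$ ($X$ a separable metric space) is Carathéodory if $t\mapsto G(t,z)$ is strongly measurable for every $z\in X$, and $z\mapsto G(t,z)$ is continuous for almost every $t\in[0,T]$. Standing assumption: (i) $A:D(A)\subset H\to H$ is the infinitesimal generator of a strongly continuous semigroup $\{e^{At}\}_{t\ge0}$ on $H$; (ii) $P:H\to H$ is linear, bounded, self-adjoint and coercive (so $P$ is invertible with bounded inverse and $P^{-1}$ is strongly monotone); (iii) $K:[0,T]\rightrightarrows H$ is a set-valued mapping with nonempty, closed, convex values; (iv) $f,h:[0,T]\times H\times H\to H$ are Carathéodory mappings (with $X=H\times H$), and $t\mapsto f(t,0,0)$ belongs to $L^1(0,T;H)$. For $t\in[0,T]$, $x\in H$ define $F_{t,x}:H\to H$ by $F_{t,x}(y):=P^{-1}y-h(t,x,P^{-1}y)$. An operator $F:H\to H$ is strongly pseudomonotone on $C\subset H$ with modulus $m>0$ if for all $y,z\in C$: $\langle F(y),z-y\rangle\ge0$ implies $\langle F(z),z-y\rangle\ge m\|z-y\|^2$. Strong pseudomonotonicity assumption: there are $\gamma>0$ and $L_F>0$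 such that for every $t\in[0,T]$ and every $x\in H$, $F_{t,x}$ is strongly pseudomonotone on $K(t)$ with modulus $\gamma$ and Lipschitz continuous on $H$ with modulus $L_F$. State-Lipschitz assumption on $h$: there exists $\alpha_h>0$ such that $\|h(t,x_1,u)-h(t,x_2,u)\|\le\alpha_h\|x_1-x_2\|$ for all $t\in[0,T]$, $x_1,x_2,u\in H$. Time regularity assumption: (i) for every $R\ge0$ there is a continuous $\omega_{K,R}:\mathbb R_+\to\mathbb R_+$ with $\lim_{r\to0^+}\omega_{K,R}(r)=0$ and $\|\mathrm{proj}_{K(t_1)}(z)-\mathrm{proj}_{K(t_2)}(z)\|\le\omega_{K,R}(|t_1-t_2|)$ for all $t_1,t_2\in[0,T]$, $z\in\mathbb B_R(0)$; (ii) for every $R\ge0$ there is a continuous $\omega_{h,R}:\mathbb R_+\to\mathbb R_+$ with $\lim_{r\to0^+}\omega_{h,R}(r)=0$ and $\|h(t_1,x,u)-h(t_2,x,u)\|\le\omega_{h,R}(|t_1-t_2|)$ for all $t_1,t_2\in[0,T]$, $x,u\in\mathbb B_R(0)$. Lipschitz assumption on $f$: there are $\alpha_f>0$, $\beta_f>0$ such that $\|f(t,x_1,u_1)-f(t,x_2,u_2)\|\le\alpha_f\|x_1-x_2\|+\beta_f\|u_1-u_2\|$ for all $t\in[0,T]$, $x_1,x_2,u_1,u_2\in H$. A mild solution pair with initial state $x_0\in H$ is a pair $(x,u)\in C([0,T];H)\times C([0,T];H)$ with $x(t)=e^{At}x_0+\int_0^te^{A(t-s)}f(s,x(s),u(s))\,ds$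 for all $t\in[0,T]$ and $u(t)\in h(t,x(t),u(t))-N_{K(t)}(Pu(t))$ for a.e. $t\in(0,T)$. *)

theory Defs
  imports "HOL-Analysis.Analysis"
begin

text \<open>
  A separable real Hilbert space is a type of sort
  \<open>{real_inner, banach, second_countable_topology}\<close>. Mappings on \<open>[0,T]\<close> are total functions
  on \<open>real\<close> whose values outside \<open>{0..T}\<close> are never constrained.
\<close>

definition c0_semigroup :: "(real \<Rightarrow> 'a::real_normed_vector \<Rightarrow> 'a) \<Rightarrow> bool" where
  "c0_semigroup S \<longleftrightarrow>
     (\<forall>t\<ge>0. bounded_linear (S t)) \<and>
     (\<forall>x. S 0 x = x) \<and>
     (\<forall>s\<ge>0. \<forall>t\<ge>0. \<forall>x. S (s + t) x = S s (S t x)) \<and>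
     (\<forall>x. ((\<lambda>t. S t x) \<longlongrightarrow> x) (at_right 0))"

text \<open>
  The generator \<open>A : D \<rightarrow> H\<close> is unbounded in general; it is given by its domain \<open>D\<close> and a total
  function \<open>A\<close> of which only the values on \<open>D\<close> matter. A strongly continuous semigroup is
  determined by its generator, so \<open>S t\<close> plays the role of \<open>e\<^sup>A\<^sup>t\<close>.
\<close>

definition infinitesimal_generator ::
  "'a::real_normed_vector set \<Rightarrow> ('a \<Rightarrow> 'a) \<Rightarrow> (real \<Rightarrow> 'a \<Rightarrow> 'a) \<Rightarrow> bool" where
  "infinitesimal_generator D A S \<longleftrightarrow>
     D = {x. \<exists>y. ((\<lambda>r. (S r x - x) /\<^sub>R r) \<longlongrightarrow> y) (at_right 0)} \<and>
     (\<forall>x\<in>D. ((\<lambda>r. (S r x - x) /\<^sub>R r) \<longlongrightarrow> A x) (at_right 0))"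

definition self_adjoint :: "('a::real_inner \<Rightarrow> 'a) \<Rightarrow> bool" where
  "self_adjoint P \<longleftrightarrow> (\<forall>x y. inner (P x) y = inner x (P y))"

definition coercive :: "('a::real_inner \<Rightarrow> 'a) \<Rightarrow> bool" where
  "coercive P \<longleftrightarrow> (\<exists>c>0. \<forall>x. inner (P x) x \<ge> c * (norm x)\<^sup>2)"

text \<open>Same definition as \<open>closest_point\<close>, which is restricted to spaces with the Heine-Borel property.\<close>

definition metric_proj :: "'a::real_inner set \<Rightarrow> 'a \<Rightarrow> 'a" where
  "metric_proj C z = (SOME p. p \<in> C \<and> (\<forall>q\<in>C. dist z p \<le> dist z q))"

definition normal_cone :: "'a::real_inner set \<Rightarrow> 'a \<Rightarrow> 'a set" where
  "normal_cone C y = (if y \<in> C then {\<xi>. \<forall>v\<in>C. inner \<xi> (v - y) \<le> 0} else {})"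

definition strongly_measurable :: "'t measure \<Rightarrow> ('t \<Rightarrow> 'a::real_normed_vector) \<Rightarrow> bool" where
  "strongly_measurable M g \<longleftrightarrow>
     (\<exists>s. (\<forall>n::nat. simple_function M (s n)) \<and> (AE t in M. (\<lambda>n. s n t) \<longlonglongrightarrow> g t))"

definition caratheodory ::
  "real \<Rightarrow> (real \<Rightarrow> 'z::{metric_space, second_countable_topology} \<Rightarrow> 'a::real_normed_vector) \<Rightarrow> bool"
where
  "caratheodory T G \<longleftrightarrow>
     (\<forall>z. strongly_measurable (lebesgue_on {0..T}) (\<lambda>t. G t z)) \<and>
     (AE t in lebesgue_on {0..T}. continuous_on UNIV (G t))"

definition F_op ::
  "('a::real_normed_vector \<Rightarrow> 'a) \<Rightarrow> (real \<Rightarrow> 'a \<Rightarrow> 'a \<Rightarrow> 'a) \<Rightarrow> real \<Rightarrow> 'a \<Rightarrow> 'a \<Rightarrow> 'a" where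
  "F_op P h t x y = inv P y - h t x (inv P y)"

definition strongly_pseudomonotone_on ::
  "'a::real_inner set \<Rightarrow> real \<Rightarrow> ('a \<Rightarrow> 'a) \<Rightarrow> bool" where
  "strongly_pseudomonotone_on C m F \<longleftrightarrow>
     (\<forall>y\<in>C. \<forall>z\<in>C. inner (F y) (z - y) \<ge> 0 \<longrightarrow> inner (F z) (z - y) \<ge> m * (norm (z - y))\<^sup>2)"

definition modulus :: "(real \<Rightarrow> real) \<Rightarrow> bool" where
  "modulus \<omega> \<longleftrightarrow> continuous_on {0..} \<omega> \<and> (\<forall>r\<ge>0. \<omega> r \<ge> 0) \<and> (\<omega> \<longlongrightarrow> 0) (at_right 0)"

text \<open>
  The integral is the Bochner integral, which the library sets to \<open>0\<close> for non-integrable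
  integrands. This default does not interfere when \<open>S\<close> is a strongly continuous semigroup,
  \<open>f\<close> is a Caratheodory mapping that is Lipschitz in its last two arguments uniformly in time,
  and \<open>f(\<cdot>,0,0)\<close> is integrable: the integrand is then integrable for all continuous \<open>x\<close>, \<open>u\<close>.
\<close>

definition mild_solution_pair ::
  "real \<Rightarrow> (real \<Rightarrow> 'a \<Rightarrow> 'a) \<Rightarrow> ('a \<Rightarrow> 'a) \<Rightarrow> (real \<Rightarrow> 'a set)
   \<Rightarrow> (real \<Rightarrow> 'a \<Rightarrow> 'a \<Rightarrow> 'a) \<Rightarrow> (real \<Rightarrow> 'a \<Rightarrow> 'a \<Rightarrow> 'a)
   \<Rightarrow> 'a \<Rightarrow> (real \<Rightarrow> 'a) \<Rightarrow> (real \<Rightarrow> 'a::{real_inner, banach, second_countable_topology}) \<Rightarrow> bool"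
where
  "mild_solution_pair T S P K f h x0 x u \<longleftrightarrow>
     continuous_on {0..T} x \<and> continuous_on {0..T} u \<and>
     (\<forall>t\<in>{0..T}. x t = S t x0 + (LINT s|lebesgue_on {0..t}. S (t - s) (f s (x s) (u s)))) \<and>
     (AE t in lebesgue_on {0<..<T}.
        u t \<in> (\<lambda>\<xi>. h t (x t) (u t) - \<xi>) ` normal_cone (K t) (P (u t)))"

end

theory Submission
  imports Defs
begin

text \<open>
  At almost every time \<open>y\<^sub>i = P u\<^sub>i\<close> solves the variational inequality of \<open>F\<^bsub>t,x\<^sub>i\<^esub>\<close> over
  \<open>K(t)\<close>. Testing each of the two inequalities with the other solution, strong
  pseudomonotonicity gives \<open>\<gamma> \<parallel>y\<^sub>1 - y\<^sub>2\<parallel> \<le> \<alpha>\<^sub>h \<parallel>x\<^sub>1 - x\<^sub>2\<parallel>\<close>, hence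
  \<open>\<parallel>u\<^sub>1 - u\<^sub>2\<parallel> \<le> L \<parallel>x\<^sub>1 - x\<^sub>2\<parallel>\<close> almost everywhere, and everywhere by continuity. The
  difference of the two integral equations then bounds \<open>e\<^sup>\<eta>\<^sup>t \<parallel>x\<^sub>1(t) - x\<^sub>2(t)\<parallel>\<close> by
  \<open>M \<parallel>x\<^sub>0\<^sub>1 - x\<^sub>0\<^sub>2\<parallel>\<close> plus \<open>M (\<alpha>\<^sub>f + \<beta>\<^sub>f L)\<close> times its own integral, and Gronwall's inequality
  concludes.
\<close>

section \<open>Real analysis\<close>

text \<open>The right-hand side of the integral inequality, multiplied by
  \<open>exp (- b * s)\<close>, is nonincreasing: its derivative is \<open>b * exp (- b * s)\<close>
  times the gap that the inequality makes nonpositive.\<close>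

lemma gronwall:
  fixes \<psi> :: "real \<Rightarrow> real"
  assumes cont: "continuous_on {0..T} \<psi>" and b: "b \<ge> 0"
    and le: "\<And>t. t \<in> {0..T} \<Longrightarrow> \<psi> t \<le> a + b * integral {0..t} \<psi>"
    and t: "t \<in> {0..T}"
  shows "\<psi> t \<le> a * exp (b * t)"
proof -
  define V where "V s = (a + b * integral {0..s} \<psi>) * exp (- b * s)" for s
  have d: "(V has_real_derivative b * exp (- b * s) * (\<psi> s - (a + b * integral {0..s} \<psi>)))
      (at s within {0..T})" if "s \<in> {0..T}" for s
    unfolding V_def
    by (rule derivative_eq_intros integral_has_real_derivative[OF cont that] refl | simp)+
       (simp add: algebra_simps)
  \<comment> \<open>The sign of the derivative is checked on the open interval, where
    \<open>at s within {0..T}\<close> is \<open>at s\<close>; continuity of \<open>V\<close> takes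
    care of the endpoints.\<close>
  have "V t \<le> V 0"
  proof (rule DERIV_nonpos_imp_decreasing_open[where f=V])
    fix s assume s: "0 < s" "s < t"
    then have "s \<in> {0..T}" "at s within {0..T} = at s"
      using t by (auto intro: at_within_Icc_at)
    then have "(V has_real_derivative b * exp (- b * s) * (\<psi> s - (a + b * integral {0..s} \<psi>))) (at s)"
      using d by metis
    moreover have "b * exp (- b * s) * (\<psi> s - (a + b * integral {0..s} \<psi>)) \<le> 0"
      using le[OF \<open>s \<in> {0..T}\<close>] b by (intro mult_nonneg_nonpos) auto
    ultimately show "\<exists>y. DERIV V s :> y \<and> y \<le> 0" by blast
  next
    have "continuous_on {0..T} V"
      using d by (blast intro: DERIV_continuous continuous_on_eq_continuous_within[THEN iffD2])
    then show "continuous_on {0..t} V"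
      by (rule continuous_on_subset) (use t in auto)
  qed (use t in auto)
  then have "a + b * integral {0..t} \<psi> \<le> a * exp (b * t)"
    by (simp add: V_def exp_minus field_simps)
  then show ?thesis using le[OF t] by linarith
qed

text \<open>The points of \<open>S\<close> violating the inequality form a set that is both open and
  negligible, hence empty; continuity then reaches the boundary. This turns the almost-everywhere
  inclusion for the controls into a bound at every time, \<open>0\<close> and \<open>T\<close>
  included.\<close>

lemma AE_le_imp_le_on_closure:
  fixes \<phi> \<psi> :: "'a::euclidean_space \<Rightarrow> real"
  assumes S: "open S" and cont: "continuous_on (closure S) \<phi>" "continuous_on (closure S) \<psi>"
    and ae: "AE t in lebesgue_on S. \<phi> t \<le> \<psi> t"
    and t: "t \<in> closure S"
  shows "\<phi> t \<le> \<psi> t"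
proof -
  define B where "B = {s \<in> S. 0 < \<phi> s - \<psi> s}"
  have cont': "continuous_on (closure S) (\<lambda>s. \<phi> s - \<psi> s)"
    by (intro continuous_intros cont)
  have "open B"
    using continuous_open_preimage[OF continuous_on_subset[OF cont' closure_subset] S, of "{0<..}"]
    by (simp add: B_def vimage_def Int_def conj_commute)
  moreover have "negligible B"
  proof -
    have "S \<in> sets lebesgue" using S by (simp add: borel_open)
    then have "AE s in lebesgue. s \<in> S \<longrightarrow> \<phi> s \<le> \<psi> s"
      using ae by (simp add: AE_restrict_space_iff)
    then have "AE s in lebesgue. s \<notin> B"
      by eventually_elim (auto simp: B_def)
    then show ?thesis
      by (simp add: completion.null_sets_iff_AE negligible_iff_null_sets)
  qed
  ultimately have "B = {}" using open_not_negligible by blast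
  then have "\<phi> s - \<psi> s \<le> 0" if "s \<in> S" for s
    using that unfolding B_def by (force simp: not_less)
  then have "\<phi> t - \<psi> t \<le> 0"
    using continuous_le_on_closure[OF cont' t] by blast
  then show ?thesis by simp
qed

lemma tendsto_if_dist_le:
  assumes "(g \<longlongrightarrow> 0) F" and "\<forall>\<^sub>F w in F. dist (f w) l \<le> g w"
  shows "(f \<longlongrightarrow> l) F"
  using assms by (subst tendsto_dist_iff) (auto intro: Lim_null_comparison)

section \<open>Measurability\<close>

lemma complete_measure_lebesgue_on:
  assumes "S \<in> sets lebesgue"
  shows "complete_measure (lebesgue_on S)"
proof
  fix A B assume "B \<subseteq> A" "A \<in> null_sets (lebesgue_on S)"
  then have "A \<in> null_sets lebesgue" "A \<subseteq> S"
    using null_sets_restrict_space[OF assms] by auto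
  then have "B \<in> null_sets lebesgue" "B \<subseteq> S"
    using \<open>B \<subseteq> A\<close> completion.complete2 by auto
  then have "B \<in> null_sets (lebesgue_on S)"
    using null_sets_restrict_space[OF assms] by auto
  then show "B \<in> sets (lebesgue_on S)" by auto
qed

text \<open>Preimages under \<open>f\<close> and \<open>g\<close> differ by subsets of a null set,
  and completeness makes those measurable.\<close>

lemma (in complete_measure) borel_measurable_cong_AE:
  assumes g: "g \<in> borel_measurable M" and ae: "AE t in M. f t = g t"
  shows "f \<in> borel_measurable M"
proof (rule measurableI)
  fix A :: "'b set" assume A: "A \<in> sets borel"
  have "AE t in M. t \<in> g -` A \<inter> space M \<longleftrightarrow> t \<in> f -` A \<inter> space M"
    using ae by eventually_elim auto
  then show "f -` A \<inter> space M \<in> sets M"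
    by (rule in_sets_AE) (use measurable_sets[OF g A] in auto)
qed auto

text \<open>The simple functions converge only almost everywhere, so \<open>g\<close> is compared
  with the total function \<open>lim\<close>, which is measurable even though its value is a mere
  default where the sequence diverges.\<close>

lemma (in complete_measure) strongly_measurable_imp_borel_measurable:
  fixes g :: "'a \<Rightarrow> 'b::{banach, second_countable_topology}"
  assumes "strongly_measurable M g"
  shows "g \<in> borel_measurable M"
proof -
  obtain s where s: "\<And>n::nat. simple_function M (s n)" "AE t in M. (\<lambda>n. s n t) \<longlonglongrightarrow> g t"
    using assms unfolding strongly_measurable_def by blast
  have [measurable]: "s n \<in> borel_measurable M" for n
    using s(1) by (rule borel_measurable_simple_function)
  have "AE t in M. g t = lim (\<lambda>n. s n t)"
    using s(2) by eventually_elim (simp add: limI)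
  then show ?thesis
    by (rule borel_measurable_cong_AE[rotated]) measurable
qed

text \<open>For simple \<open>s i\<close>, the map \<open>G t (s i t)\<close> is glued from finitely
  many sections \<open>G t z\<close> with \<open>z\<close> fixed; continuity in the second argument
  passes to the limit.\<close>

lemma borel_measurable_caratheodory_compose:
  fixes G :: "'t \<Rightarrow> 'z::{metric_space, second_countable_topology} \<Rightarrow> 'b::metric_space"
  assumes meas: "\<And>z. (\<lambda>t. G t z) \<in> borel_measurable M"
    and cont: "\<And>t. t \<in> space M \<Longrightarrow> continuous_on UNIV (G t)"
    and g: "g \<in> borel_measurable M"
  shows "(\<lambda>t. G t (g t)) \<in> borel_measurable M"
proof -
  obtain s where s: "\<And>i. simple_function M (s i)"
    and lim: "\<And>t. t \<in> space M \<Longrightarrow> (\<lambda>i. s i t) \<longlonglongrightarrow> g t"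
    using borel_measurable_implies_sequence_metric[OF g] by blast
  show ?thesis
  proof (rule borel_measurable_LIMSEQ_metric)
    show "(\<lambda>t. G t (s i t)) \<in> borel_measurable M" for i
    proof (rule measurable_compose_countable'[where f="\<lambda>z t. G t z" and I="s i ` space M"])
      show "s i \<in> measurable M (count_space (s i ` space M))"
        using s[of i] by (rule measurable_simple_function[THEN measurable_count_space_extend[rotated 2]]) auto
      show "countable (s i ` space M)"
        using simple_functionD(1)[OF s] by (rule countable_finite)
    qed (rule meas)
    show "(\<lambda>i. G t (s i t)) \<longlonglongrightarrow> G t (g t)" if "t \<in> space M" for t
      using continuous_on_tendsto_compose[OF cont[OF that] lim[OF that]] by simp
  qed
qed

lemma integrable_lebesgue_on_subset:
  fixes f :: "'a::euclidean_space \<Rightarrow> 'b::{banach, second_countable_topology}"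
  assumes "integrable (lebesgue_on A) f" "A \<in> sets lebesgue" "B \<in> sets lebesgue" "B \<subseteq> A"
  shows "integrable (lebesgue_on B) f"
  using set_integrable_subset[of lebesgue A f B] assms
  by (simp add: integrable_restrict_space set_integrable_def)

section \<open>Coercive operators and exponentially bounded semigroups\<close>

text \<open>
  Lax-Milgram without duality: \<open>P x = y\<close> is solved by the fixed point of
  \<open>x \<mapsto> x - \<rho> (P x - y)\<close>, a contraction for \<open>\<rho> = c / B\<^sup>2\<close>.
\<close>

lemma coercive_bij:
  fixes P :: "'a::{real_inner, banach} \<Rightarrow> 'a"
  assumes P: "bounded_linear P" and co: "coercive P"
  shows "bij P"
    and "bounded_linear (inv P)"
proof -
  interpret P: bounded_linear P by (rule P)
  obtain c where c: "c > 0" and lower: "\<And>x. inner (P x) x \<ge> c * (norm x)\<^sup>2"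
    using co unfolding coercive_def by blast
  \<comment> \<open>This lower bound yields injectivity of \<open>P\<close> and, later, the bound
    \<open>1 / c\<close> for its inverse.\<close>
  have norm_lower: "c * norm x \<le> norm (P x)" for x
  proof (cases "x = 0")
    case False
    have "c * norm x * norm x \<le> norm (P x) * norm x"
      using lower[of x] norm_cauchy_schwarz[of "P x" x] by (simp add: power2_eq_square)
    then show ?thesis using False by simp
  qed simp
  have inj: "inj P"
    unfolding linear_injective_0[OF P.linear_axioms]
    using norm_lower c by (metis mult_le_0_iff norm_le_zero_iff norm_zero not_less)
  obtain B0 where B0: "\<And>x. norm (P x) \<le> norm x * B0" using P.bounded by blast
  \<comment> \<open>Adding \<open>c\<close> to the absolute value ensures \<open>B > 0\<close> and
    \<open>c / B \<le> 1\<close>, so the contraction factor is the root of a nonnegative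
    number.\<close>
  define B where "B = \<bar>B0\<bar> + c"
  have B: "B \<ge> c" "B > 0" and B': "norm (P x) \<le> B * norm x" for x
    using c order_trans[OF B0[of x] mult_left_mono[of B0 "\<bar>B0\<bar> + c" "norm x"]]
    by (auto simp: B_def mult.commute)
  \<comment> \<open>The choice \<open>c / B\<^sup>2\<close> of \<rho> minimizes
    \<open>1 - 2 * \<rho> * c + \<rho>\<^sup>2 * B\<^sup>2\<close>, the factor obtained by expanding
    the square.\<close>
  have contraction: "norm (x - (c / B\<^sup>2) *\<^sub>R P x) \<le> sqrt (1 - c\<^sup>2 / B\<^sup>2) * norm x" for x
  proof -
    have "(norm (x - (c / B\<^sup>2) *\<^sub>R P x))\<^sup>2
        = (norm x)\<^sup>2 - 2 * (c / B\<^sup>2) * inner (P x) x + (c / B\<^sup>2)\<^sup>2 * (norm (P x))\<^sup>2"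
      unfolding power2_norm_eq_inner
      by (simp add: inner_diff_left inner_diff_right inner_commute power2_eq_square)
    also have "\<dots> \<le> (norm x)\<^sup>2 - 2 * (c / B\<^sup>2) * (c * (norm x)\<^sup>2) + (c / B\<^sup>2)\<^sup>2 * (B * norm x)\<^sup>2"
      using lower[of x] power_mono[OF B', of x 2] c B
      by (intro add_mono diff_mono mult_left_mono order_refl) auto
    also have "\<dots> = (1 - c\<^sup>2 / B\<^sup>2) * (norm x)\<^sup>2"
      using B by (simp add: field_simps power2_eq_square)
    finally show ?thesis
      by (metis abs_norm_cancel real_le_rsqrt real_sqrt_abs real_sqrt_mult)
  qed
  have "\<exists>x. P x = y" for y
  proof -
    have "c\<^sup>2 / B\<^sup>2 \<le> 1" "c\<^sup>2 / B\<^sup>2 > 0"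
      using c B power_mono[of c B 2] by (auto simp: divide_simps)
    then have "\<exists>!x. x - (c / B\<^sup>2) *\<^sub>R (P x - y) = x"
    proof (intro banach_fix_type allI)
      show "dist (x - (c / B\<^sup>2) *\<^sub>R (P x - y)) (z - (c / B\<^sup>2) *\<^sub>R (P z - y))
          \<le> sqrt (1 - c\<^sup>2 / B\<^sup>2) * dist x z" for x z
        using contraction[of "x - z"] by (simp add: dist_norm P.diff algebra_simps)
    qed auto
    then show ?thesis using c B by auto
  qed
  then show bij: "bij P" using inj by (metis bijI surjI surj_def)
  have PinvP: "P (inv P y) = y" for y using bij by (simp add: bij_is_surj surj_f_inv_f)
  show "bounded_linear (inv P)"
  proof (rule bounded_linear_intro[where K="1 / c"])
    show "inv P (x + y) = inv P x + inv P y" for x y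
      by (rule injD[OF inj]) (simp add: PinvP P.add)
    show "inv P (r *\<^sub>R x) = r *\<^sub>R inv P x" for r x
      by (rule injD[OF inj]) (simp add: PinvP P.scaleR)
    show "norm (inv P x) \<le> norm x * (1 / c)" for x
      using norm_lower[of "inv P x"] c by (simp add: PinvP field_simps)
  qed
qed

text \<open>For \<open>a \<le> b\<close> the increment is \<open>S a\<close> applied to
  \<open>S (b - a) x - x\<close>, so the uniform bound reduces continuity at every time to right
  continuity at \<open>0\<close>.\<close>

lemma c0_semigroup_strongly_continuous:
  fixes S :: "real \<Rightarrow> 'a::real_normed_vector \<Rightarrow> 'a"
  assumes S: "c0_semigroup S" and bound: "\<And>t x. t \<ge> 0 \<Longrightarrow> norm (S t x) \<le> B * norm x"
  shows "continuous_on {0..} (\<lambda>t. S t x)"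
proof -
  have S0: "S 0 x = x" and lin: "\<And>t. t \<ge> 0 \<Longrightarrow> bounded_linear (S t)"
    and add: "\<And>s t. s \<ge> 0 \<Longrightarrow> t \<ge> 0 \<Longrightarrow> S (s + t) x = S s (S t x)"
    and lim: "((\<lambda>t. S t x) \<longlongrightarrow> x) (at_right 0)"
    using S unfolding c0_semigroup_def by auto
  have step: "norm (S b x - S a x) \<le> B * norm (S (b - a) x - x)" if "0 \<le> a" "a \<le> b" for a b
  proof -
    have "S b x - S a x = S a (S (b - a) x - x)"
      using that add[of a "b - a"] linear_diff[OF bounded_linear.linear[OF lin]] by simp
    then show ?thesis using bound[of a] that by simp
  qed
  \<comment> \<open>The absolute value treats times on both sides of \<open>t\<close> at
    once.\<close>
  have sym: "dist (S s x) (S t x) \<le> B * norm (S \<bar>s - t\<bar> x - x)" if "s \<ge> 0" "t \<ge> 0" for s t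
    using step[of s t] step[of t s] that
    by (cases "s \<le> t") (auto simp: dist_norm norm_minus_commute abs_if)
  have "((\<lambda>t. S t x) \<longlongrightarrow> x) (at 0 within {0..})"
    using lim by (simp add: at_within_Ici_at_right)
  then have zero: "continuous (at 0 within {0..}) (\<lambda>t. S t x)"
    by (simp add: continuous_within S0)
  show ?thesis
    unfolding continuous_on_def
  proof
    fix t :: real assume t: "t \<in> {0..}"
    have "((\<lambda>s. S \<bar>s - t\<bar> x) \<longlongrightarrow> S 0 x) (at t within {0..})"
    proof (rule continuous_within_tendsto_compose[OF zero])
      have "((\<lambda>s. \<bar>s - t\<bar>) \<longlongrightarrow> \<bar>t - t\<bar>) (at t within {0..})" by (intro tendsto_intros)
      then show "((\<lambda>s. \<bar>s - t\<bar>) \<longlongrightarrow> 0) (at t within {0..})" by simp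
    qed auto
    then have "((\<lambda>s. B * norm (S \<bar>s - t\<bar> x - x)) \<longlongrightarrow> B * norm (S 0 x - x)) (at t within {0..})"
      by (intro tendsto_intros)
    then have "((\<lambda>s. B * norm (S \<bar>s - t\<bar> x - x)) \<longlongrightarrow> 0) (at t within {0..})"
      by (simp add: S0)
    moreover have "\<forall>\<^sub>F s in at t within {0..}. dist (S s x) (S t x) \<le> B * norm (S \<bar>s - t\<bar> x - x)"
      using sym t by (auto simp: eventually_at_filter intro: always_eventually)
    ultimately show "((\<lambda>s. S s x) \<longlongrightarrow> S t x) (at t within {0..})"
      by (rule tendsto_if_dist_le)
  qed
qed

section \<open>The two estimates\<close>

text \<open>Each inequality is tested with the other solution. Pseudomonotonicity moves the first
  from \<open>F y\<close> to \<open>F z\<close>; subtracting the second leaves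
  \<open>F z - G z\<close>, and Cauchy-Schwarz finishes.\<close>

lemma variational_inequality_stability:
  assumes mono: "strongly_pseudomonotone_on C \<gamma> F" and \<gamma>: "\<gamma> > 0"
    and sol: "y \<in> C" "z \<in> C" "- F y \<in> normal_cone C y" "- G z \<in> normal_cone C z"
  shows "\<gamma> * norm (y - z) \<le> norm (F z - G z)"
proof (cases "y = z")
  case False
  have "inner (F y) (z - y) \<ge> 0" "inner (G z) (y - z) \<ge> 0"
    using sol by (auto simp: normal_cone_def)
  then have "\<gamma> * (norm (z - y))\<^sup>2 \<le> inner (F z) (z - y)" "inner (G z) (z - y) \<le> 0"
    using mono sol by (auto simp: strongly_pseudomonotone_on_def inner_diff_right)
  then have "\<gamma> * (norm (z - y))\<^sup>2 \<le> inner (F z - G z) (z - y)"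
    by (simp add: inner_diff_left)
  also have "\<dots> \<le> norm (F z - G z) * norm (z - y)" by (rule norm_cauchy_schwarz)
  finally show ?thesis
    using False by (simp add: power2_eq_square norm_minus_commute)
qed simp

text \<open>Since \<open>F_op\<close> at \<open>P v\<close> is \<open>v - h t x v\<close>, each
  inclusion is a variational inequality for \<open>P u\<close>. At the common point
  \<open>P u\<^sub>2\<close> the two operators differ only through the state argument of
  \<open>h\<close>; \<open>inv P\<close> carries the estimate back to the controls.\<close>

lemma control_difference_le:
  fixes u\<^sub>1 u\<^sub>2 :: "'a::{real_inner, banach}"
  assumes P: "bounded_linear P" "coercive P" and \<gamma>: "\<gamma> > 0"
    and mono: "strongly_pseudomonotone_on C \<gamma> (F_op P h t x\<^sub>1)"
    and h: "norm (h t x\<^sub>1 u\<^sub>2 - h t x\<^sub>2 u\<^sub>2) \<le> \<alpha> * norm (x\<^sub>1 - x\<^sub>2)"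
    and u: "u\<^sub>1 \<in> (\<lambda>\<xi>. h t x\<^sub>1 u\<^sub>1 - \<xi>) ` normal_cone C (P u\<^sub>1)"
      "u\<^sub>2 \<in> (\<lambda>\<xi>. h t x\<^sub>2 u\<^sub>2 - \<xi>) ` normal_cone C (P u\<^sub>2)"
  shows "norm (u\<^sub>1 - u\<^sub>2) \<le> \<alpha> * onorm (inv P) / \<gamma> * norm (x\<^sub>1 - x\<^sub>2)"
proof -
  have inv: "inv P (P v) = v" for v
    using coercive_bij(1)[OF P] by (simp add: bij_is_inj)
  have F: "F_op P h t x (P v) = v - h t x v" for x v by (simp add: F_op_def inv)
  have "a - v \<in> N" if "v \<in> (\<lambda>\<xi>. a - \<xi>) ` N" for a v :: 'a and N
    using that by force
  then have "- F_op P h t x\<^sub>1 (P u\<^sub>1) \<in> normal_cone C (P u\<^sub>1)"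
    "- F_op P h t x\<^sub>2 (P u\<^sub>2) \<in> normal_cone C (P u\<^sub>2)"
    using u by (simp_all add: F)
  \<comment> \<open>The normal cone is empty off \<open>C\<close>, so having an element forces
    membership.\<close>
  moreover from this have "P u\<^sub>1 \<in> C" "P u\<^sub>2 \<in> C"
    by (auto simp: normal_cone_def split: if_splits)
  ultimately have "\<gamma> * norm (P u\<^sub>1 - P u\<^sub>2)
      \<le> norm (F_op P h t x\<^sub>1 (P u\<^sub>2) - F_op P h t x\<^sub>2 (P u\<^sub>2))"
    by (intro variational_inequality_stability[OF mono \<gamma>])
  also have "\<dots> \<le> \<alpha> * norm (x\<^sub>1 - x\<^sub>2)" using h by (simp add: F norm_minus_commute)
  finally have *: "norm (P u\<^sub>1 - P u\<^sub>2) \<le> \<alpha> * norm (x\<^sub>1 - x\<^sub>2) / \<gamma>"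
    using \<gamma> by (simp add: field_simps)
  have "norm (u\<^sub>1 - u\<^sub>2) = norm (inv P (P u\<^sub>1 - P u\<^sub>2))"
    by (simp add: linear_diff[OF bounded_linear.linear[OF coercive_bij(2)[OF P]]] inv)
  also have "\<dots> \<le> onorm (inv P) * norm (P u\<^sub>1 - P u\<^sub>2)"
    by (rule onorm[OF coercive_bij(2)[OF P]])
  also have "\<dots> \<le> onorm (inv P) * (\<alpha> * norm (x\<^sub>1 - x\<^sub>2) / \<gamma>)"
    by (intro mult_left_mono * onorm_pos_le coercive_bij(2)[OF P])
  finally show ?thesis by (simp add: mult_ac)
qed

text \<open>Integrability allows the difference of two mild solution integrals to be written as one
  integral. The integrand is dominated by comparing \<open>f\<close> with \<open>f s 0 0\<close>, as
  \<open>x\<close> and \<open>u\<close> are bounded on the compact interval.\<close>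

lemma mild_integrand_integrable:
  fixes f :: "real \<Rightarrow> 'a \<Rightarrow> 'a \<Rightarrow> 'a::{real_inner, banach, second_countable_topology}"
  assumes S: "c0_semigroup S" and bound: "\<And>t x. t \<ge> 0 \<Longrightarrow> norm (S t x) \<le> B * norm x"
    and car: "caratheodory T (\<lambda>t (x, u). f t x u)"
    and L1: "integrable (lebesgue_on {0..T}) (\<lambda>t. f t 0 0)"
    and lip: "\<And>t x y u v. t \<in> {0..T} \<Longrightarrow>
         norm (f t x u - f t y v) \<le> \<alpha> * norm (x - y) + \<beta> * norm (u - v)"
    and pos: "B \<ge> 0" "\<alpha> \<ge> 0" "\<beta> \<ge> 0"
    and x: "continuous_on {0..T} x" and u: "continuous_on {0..T} u"
    and t: "t \<in> {0..T}"
  shows "integrable (lebesgue_on {0..t}) (\<lambda>s. S (t - s) (f s (x s) (u s)))"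
proof -
  interpret complete_measure "lebesgue_on {0..T}" by (rule complete_measure_lebesgue_on) simp
  have sub: "{0..t} \<subseteq> {0..T}" using t by auto
  \<comment> \<open>The Lipschitz bound gives joint continuity at every time, as the composition
    lemma requires, rather than at almost every time.\<close>
  have cont_f: "continuous_on UNIV (\<lambda>(x, u). f s x u)" if s: "s \<in> {0..T}" for s
    unfolding continuous_on_def
  proof
    fix z :: "'a \<times> 'a"
    have "((\<lambda>w. \<alpha> * norm (fst w - fst z) + \<beta> * norm (snd w - snd z))
        \<longlongrightarrow> \<alpha> * norm (fst z - fst z) + \<beta> * norm (snd z - snd z)) (at z)"
      by (intro tendsto_intros)
    then have "((\<lambda>w. \<alpha> * norm (fst w - fst z) + \<beta> * norm (snd w - snd z)) \<longlongrightarrow> 0) (at z)"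
      by simp
    moreover have "\<forall>\<^sub>F w in at z. dist (f s (fst w) (snd w)) (f s (fst z) (snd z))
        \<le> \<alpha> * norm (fst w - fst z) + \<beta> * norm (snd w - snd z)"
      unfolding dist_norm by (intro always_eventually allI lip[OF s])
    ultimately have "((\<lambda>w. f s (fst w) (snd w)) \<longlongrightarrow> f s (fst z) (snd z)) (at z)"
      by (rule tendsto_if_dist_le)
    then show "((\<lambda>(x, u). f s x u) \<longlongrightarrow> (case z of (x, u) \<Rightarrow> f s x u)) (at z)"
      by (simp add: case_prod_unfold)
  qed
  have "(\<lambda>s. f s (x s) (u s)) \<in> borel_measurable (lebesgue_on {0..T})"
  proof -
    have "(\<lambda>s. (\<lambda>(x, u). f s x u) (x s, u s)) \<in> borel_measurable (lebesgue_on {0..T})"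
    proof (rule borel_measurable_caratheodory_compose[where G="\<lambda>s (x, u). f s x u"])
      show "(\<lambda>s. (\<lambda>(x, u). f s x u) z) \<in> borel_measurable (lebesgue_on {0..T})" for z
        using car strongly_measurable_imp_borel_measurable unfolding caratheodory_def by blast
      show "(\<lambda>s. (x s, u s)) \<in> borel_measurable (lebesgue_on {0..T})"
        by (intro continuous_imp_measurable_on_sets_lebesgue continuous_intros x u) simp
    qed (use cont_f in auto)
    then show ?thesis by simp
  qed
  then have meas_f: "(\<lambda>s. f s (x s) (u s)) \<in> borel_measurable (lebesgue_on {0..t})"
    using sub by (rule measurable_restrict_mono)
  \<comment> \<open>Second use of the composition lemma: \<open>S (t - s) z\<close> is continuous in
    \<open>s\<close> by strong continuity and in \<open>z\<close> by boundedness.\<close>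
  have meas: "(\<lambda>s. S (t - s) (f s (x s) (u s))) \<in> borel_measurable (lebesgue_on {0..t})"
  proof (rule borel_measurable_caratheodory_compose[where G="\<lambda>s. S (t - s)", OF _ _ meas_f])
    show "(\<lambda>s. S (t - s) z) \<in> borel_measurable (lebesgue_on {0..t})" for z
      by (intro continuous_imp_measurable_on_sets_lebesgue
          continuous_on_compose2[OF c0_semigroup_strongly_continuous[OF S bound]] continuous_intros) auto
    show "continuous_on UNIV (S (t - s))" if "s \<in> space (lebesgue_on {0..t})" for s
      using S that by (intro linear_continuous_on) (auto simp: c0_semigroup_def)
  qed
  obtain X where X: "\<And>s. s \<in> {0..T} \<Longrightarrow> norm (x s) \<le> X"
    using compact_imp_bounded[OF compact_continuous_image[OF x]] unfolding bounded_iff by blast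
  obtain U where U: "\<And>s. s \<in> {0..T} \<Longrightarrow> norm (u s) \<le> U"
    using compact_imp_bounded[OF compact_continuous_image[OF u]] unfolding bounded_iff by blast
  show ?thesis
  proof (rule Bochner_Integration.integrable_bound[OF _ meas])
    show "integrable (lebesgue_on {0..t}) (\<lambda>s. B * (norm (f s 0 0) + (\<alpha> * X + \<beta> * U)))"
      using integrable_lebesgue_on_subset[OF L1 _ _ sub]
      by (intro integrable_mult_right Bochner_Integration.integrable_add integrable_norm)
        (auto intro: finite_measure.integrable_const finite_measure_lebesgue_on)
    show "AE s in lebesgue_on {0..t}. norm (S (t - s) (f s (x s) (u s)))
        \<le> norm (B * (norm (f s 0 0) + (\<alpha> * X + \<beta> * U)))"
    proof (rule AE_I2)
      fix s assume "s \<in> space (lebesgue_on {0..t})"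
      then have s: "s \<in> {0..T}" "s \<le> t" using sub by auto
      have "norm (f s (x s) (u s)) \<le> norm (f s 0 0) + norm (f s (x s) (u s) - f s 0 0)"
        using norm_triangle_sub by blast
      also have "\<dots> \<le> norm (f s 0 0) + (\<alpha> * X + \<beta> * U)"
        using lip[OF s(1), of "x s" "u s" 0 0] mult_left_mono[OF X[OF s(1)], of \<alpha>]
          mult_left_mono[OF U[OF s(1)], of \<beta>] pos by simp
      finally have "B * norm (f s (x s) (u s)) \<le> B * (norm (f s 0 0) + (\<alpha> * X + \<beta> * U))"
        using pos by (intro mult_left_mono) auto
      then show "norm (S (t - s) (f s (x s) (u s)))
          \<le> norm (B * (norm (f s 0 0) + (\<alpha> * X + \<beta> * U)))"
        using bound[of "t - s" "f s (x s) (u s)"] s by simp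
    qed
  qed
qed

section \<open>Exponential stability of mild solution pairs\<close>

theorem corollary5p4:
  fixes T :: real
    and D :: "'a::{real_inner, banach, second_countable_topology} set"
    and A :: "'a \<Rightarrow> 'a"
    and S :: "real \<Rightarrow> 'a \<Rightarrow> 'a"
    and P :: "'a \<Rightarrow> 'a"
    and K :: "real \<Rightarrow> 'a set"
    and f h :: "real \<Rightarrow> 'a \<Rightarrow> 'a \<Rightarrow> 'a"
    and \<gamma> L\<^sub>F \<alpha>\<^sub>h \<alpha>\<^sub>f \<beta>\<^sub>f L L' M \<eta> :: real
    and x\<^sub>0\<^sub>1 x\<^sub>0\<^sub>2 :: 'a
    and x\<^sub>1 u\<^sub>1 x\<^sub>2 u\<^sub>2 :: "real \<Rightarrow> 'a"
  assumes T_pos: "T > 0"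
    and semigroup: "c0_semigroup S"
    and generator: "infinitesimal_generator D A S"
    and P: "bounded_linear P" "self_adjoint P" "coercive P"
    and K: "\<And>t. t \<in> {0..T} \<Longrightarrow> K t \<noteq> {} \<and> closed (K t) \<and> convex (K t)"
    and f_caratheodory: "caratheodory T (\<lambda>t (x, u). f t x u)"
    and h_caratheodory: "caratheodory T (\<lambda>t (x, u). h t x u)"
    and f_L1: "integrable (lebesgue_on {0..T}) (\<lambda>t. f t 0 0)"
    and F_moduli_pos: "\<gamma> > 0" "L\<^sub>F > 0"
    and F_pseudomonotone:
      "\<And>t x. t \<in> {0..T} \<Longrightarrow> strongly_pseudomonotone_on (K t) \<gamma> (F_op P h t x)"
    and F_Lipschitz: "\<And>t x. t \<in> {0..T} \<Longrightarrow> L\<^sub>F-lipschitz_on UNIV (F_op P h t x)"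
    and \<alpha>\<^sub>h_pos: "\<alpha>\<^sub>h > 0"
    and h_Lipschitz: "\<And>t x y u. t \<in> {0..T} \<Longrightarrow> norm (h t x u - h t y u) \<le> \<alpha>\<^sub>h * norm (x - y)"
    and K_time_regular:
      "\<And>R. R \<ge> 0 \<Longrightarrow> \<exists>\<omega>. modulus \<omega> \<and>
         (\<forall>t\<in>{0..T}. \<forall>s\<in>{0..T}. \<forall>z\<in>cball 0 R.
            norm (metric_proj (K t) z - metric_proj (K s) z) \<le> \<omega> \<bar>t - s\<bar>)"
    and h_time_regular:
      "\<And>R. R \<ge> 0 \<Longrightarrow> \<exists>\<omega>. modulus \<omega> \<and>
         (\<forall>t\<in>{0..T}. \<forall>s\<in>{0..T}. \<forall>x\<in>cball 0 R. \<forall>u\<in>cball 0 R.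
            norm (h t x u - h s x u) \<le> \<omega> \<bar>t - s\<bar>)"
    and f_constants_pos: "\<alpha>\<^sub>f > 0" "\<beta>\<^sub>f > 0"
    and f_Lipschitz:
      "\<And>t x y u v. t \<in> {0..T} \<Longrightarrow>
         norm (f t x u - f t y v) \<le> \<alpha>\<^sub>f * norm (x - y) + \<beta>\<^sub>f * norm (u - v)"
    and L: "L = \<alpha>\<^sub>h * onorm (inv P) / \<gamma>"
    and L': "L' = \<alpha>\<^sub>f + \<beta>\<^sub>f * L"
    and decay_constants: "M \<ge> 1" "\<eta> > M * L'"
    and decay: "\<And>t. t \<ge> 0 \<Longrightarrow> onorm (S t) \<le> M * exp (- \<eta> * t)"
    and solution\<^sub>1: "mild_solution_pair T S P K f h x\<^sub>0\<^sub>1 x\<^sub>1 u\<^sub>1"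
    and solution\<^sub>2: "mild_solution_pair T S P K f h x\<^sub>0\<^sub>2 x\<^sub>2 u\<^sub>2"
  shows "\<forall>t\<in>{0..T}.
           norm (x\<^sub>1 t - x\<^sub>2 t) \<le> M * exp (- (\<eta> - M * L') * t) * norm (x\<^sub>0\<^sub>1 - x\<^sub>0\<^sub>2) \<and>
           norm (u\<^sub>1 t - u\<^sub>2 t) \<le> L * M * exp (- (\<eta> - M * L') * t) * norm (x\<^sub>0\<^sub>1 - x\<^sub>0\<^sub>2)"
proof -
  have u_cont: "continuous_on {0..T} u\<^sub>1" "continuous_on {0..T} u\<^sub>2"
    and x_cont: "continuous_on {0..T} x\<^sub>1" "continuous_on {0..T} x\<^sub>2"
    using solution\<^sub>1 solution\<^sub>2 unfolding mild_solution_pair_def by blast+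
  have inv_P: "bounded_linear (inv P)" by (rule coercive_bij(2)[OF P(1,3)])
  have L_nonneg: "L \<ge> 0"
    using \<alpha>\<^sub>h_pos F_moduli_pos onorm_pos_le[OF inv_P] by (simp add: L)
  then have rate_nonneg: "M * L' \<ge> 0"
    using f_constants_pos decay_constants by (simp add: L')
  have u_le: "norm (u\<^sub>1 t - u\<^sub>2 t) \<le> L * norm (x\<^sub>1 t - x\<^sub>2 t)" if t: "t \<in> {0..T}" for t
  proof (rule AE_le_imp_le_on_closure[where S="{0<..<T}" and \<phi>="\<lambda>t. norm (u\<^sub>1 t - u\<^sub>2 t)"
        and \<psi>="\<lambda>t. L * norm (x\<^sub>1 t - x\<^sub>2 t)"])
    show "t \<in> closure {0<..<T}" using t T_pos by simp
    have "AE s in lebesgue_on {0<..<T}. s \<in> {0..T}"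
      by (rule AE_I2) simp
    moreover have
      "AE s in lebesgue_on {0<..<T}.
        u\<^sub>1 s \<in> (\<lambda>\<xi>. h s (x\<^sub>1 s) (u\<^sub>1 s) - \<xi>) ` normal_cone (K s) (P (u\<^sub>1 s))"
      "AE s in lebesgue_on {0<..<T}.
        u\<^sub>2 s \<in> (\<lambda>\<xi>. h s (x\<^sub>2 s) (u\<^sub>2 s) - \<xi>) ` normal_cone (K s) (P (u\<^sub>2 s))"
      using solution\<^sub>1 solution\<^sub>2 unfolding mild_solution_pair_def by blast+
    ultimately show "AE s in lebesgue_on {0<..<T}. norm (u\<^sub>1 s - u\<^sub>2 s) \<le> L * norm (x\<^sub>1 s - x\<^sub>2 s)"
      unfolding L
      by eventually_elim
        (rule control_difference_le[OF P(1,3) F_moduli_pos(1) F_pseudomonotone h_Lipschitz])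
  qed (use T_pos in \<open>auto intro!: continuous_intros u_cont x_cont\<close>)

  have S_lin: "bounded_linear (S t)" if "t \<ge> 0" for t
    using semigroup that by (simp add: c0_semigroup_def)
  have S_decay: "norm (S t z) \<le> M * exp (- \<eta> * t) * norm z" if "t \<ge> 0" for t z
    using onorm[OF S_lin[OF that], of z] mult_right_mono[OF decay[OF that], of "norm z"] by simp
  have "\<eta> > 0" using rate_nonneg decay_constants by linarith
  \<comment> \<open>The integrability lemma asks for a bound independent of time; the decaying
    factor is at most \<open>1\<close>.\<close>
  have S_bound: "norm (S t z) \<le> M * norm z" if "t \<ge> 0" for t z
  proof -
    have "M * exp (- \<eta> * t) * norm z \<le> M * 1 * norm z"
      using \<open>\<eta> > 0\<close> that decay_constants by (intro mult_right_mono mult_left_mono) auto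
    then show ?thesis using S_decay[OF that, of z] by simp
  qed
  \<comment> \<open>The weight cancels the decay: \<open>exp (- \<eta> * (t - s))\<close> splits
    into \<open>exp (- \<eta> * t)\<close>, which leaves the integral, and
    \<open>exp (\<eta> * s)\<close>, which \<psi> absorbs. What remains has Gronwall form.\<close>
  define \<psi> where "\<psi> t = exp (\<eta> * t) * norm (x\<^sub>1 t - x\<^sub>2 t)" for t
  have \<psi>_cont: "continuous_on {0..T} \<psi>"
    unfolding \<psi>_def by (intro continuous_intros x_cont)
  have \<psi>_le: "\<psi> t \<le> M * norm (x\<^sub>0\<^sub>1 - x\<^sub>0\<^sub>2) + M * L' * integral {0..t} \<psi>" if t: "t \<in> {0..T}" for t
  proof -
    let ?I = "lebesgue_on {0..t}"
    let ?g1 = "\<lambda>s. f s (x\<^sub>1 s) (u\<^sub>1 s)" and ?g2 = "\<lambda>s. f s (x\<^sub>2 s) (u\<^sub>2 s)"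
    have M0: "0 \<le> M" and ab: "0 \<le> \<alpha>\<^sub>f" "0 \<le> \<beta>\<^sub>f"
      using decay_constants f_constants_pos by auto
    have int: "integrable ?I (\<lambda>s. S (t - s) (?g1 s))" "integrable ?I (\<lambda>s. S (t - s) (?g2 s))"
      using mild_integrand_integrable[OF semigroup S_bound f_caratheodory f_L1 f_Lipschitz M0 ab]
        x_cont u_cont t by auto
    have \<psi>_int: "integrable ?I \<psi>"
      by (rule continuous_imp_integrable_real) (rule continuous_on_subset[OF \<psi>_cont], use t in auto)
    have "x\<^sub>1 t = S t x\<^sub>0\<^sub>1 + (LINT s|?I. S (t - s) (?g1 s))"
      "x\<^sub>2 t = S t x\<^sub>0\<^sub>2 + (LINT s|?I. S (t - s) (?g2 s))"
      using solution\<^sub>1 solution\<^sub>2 t unfolding mild_solution_pair_def by blast+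
    then have "x\<^sub>1 t - x\<^sub>2 t = (S t x\<^sub>0\<^sub>1 - S t x\<^sub>0\<^sub>2)
        + ((LINT s|?I. S (t - s) (?g1 s)) - (LINT s|?I. S (t - s) (?g2 s)))"
      by (simp only: add_diff_add)
    also have "\<dots> = S t (x\<^sub>0\<^sub>1 - x\<^sub>0\<^sub>2) + (LINT s|?I. S (t - s) (?g1 s) - S (t - s) (?g2 s))"
      using t by (simp add: linear_diff[OF bounded_linear.linear[OF S_lin]] Bochner_Integration.integral_diff[OF int])
    also have "norm \<dots> \<le> norm (S t (x\<^sub>0\<^sub>1 - x\<^sub>0\<^sub>2))
        + (LINT s|?I. norm (S (t - s) (?g1 s) - S (t - s) (?g2 s)))"
      by (intro norm_triangle_mono order_refl integral_norm_bound)
    also have "(LINT s|?I. norm (S (t - s) (?g1 s) - S (t - s) (?g2 s)))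
        \<le> (LINT s|?I. exp (- \<eta> * t) * (M * L') * \<psi> s)"
    proof (rule integral_mono)
      fix s assume "s \<in> space ?I"
      then have s: "s \<in> {0..T}" "s \<le> t" using t by auto
      have "norm (?g1 s - ?g2 s) \<le> \<alpha>\<^sub>f * norm (x\<^sub>1 s - x\<^sub>2 s) + \<beta>\<^sub>f * norm (u\<^sub>1 s - u\<^sub>2 s)"
        by (rule f_Lipschitz[OF s(1)])
      \<comment> \<open>The control bound \<open>u_le\<close> eliminates the controls, which is
        where the constant \<open>\<alpha>\<^sub>f + \<beta>\<^sub>f * L\<close> originates.\<close>
      also have "\<dots> \<le> L' * norm (x\<^sub>1 s - x\<^sub>2 s)"
        using mult_left_mono[OF u_le[OF s(1)] ab(2)] by (simp add: L' algebra_simps)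
      finally have g: "norm (?g1 s - ?g2 s) \<le> L' * norm (x\<^sub>1 s - x\<^sub>2 s)" .
      have "norm (S (t - s) (?g1 s) - S (t - s) (?g2 s)) = norm (S (t - s) (?g1 s - ?g2 s))"
        using s by (simp add: linear_diff[OF bounded_linear.linear[OF S_lin]])
      also have "\<dots> \<le> M * exp (- \<eta> * (t - s)) * norm (?g1 s - ?g2 s)"
        using s by (intro S_decay) simp
      also have "\<dots> \<le> M * exp (- \<eta> * (t - s)) * (L' * norm (x\<^sub>1 s - x\<^sub>2 s))"
        using M0 by (intro mult_left_mono g) simp
      also have "\<dots> = exp (- \<eta> * t) * (M * L') * \<psi> s"
        by (simp add: \<psi>_def right_diff_distrib exp_diff exp_minus field_simps)
      finally show "norm (S (t - s) (?g1 s) - S (t - s) (?g2 s))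
          \<le> exp (- \<eta> * t) * (M * L') * \<psi> s" .
    qed (intro integrable_norm Bochner_Integration.integrable_diff int integrable_mult_right \<psi>_int)+
    \<comment> \<open>Here the Lebesgue integral becomes the gauge integral in which
      \<open>gronwall\<close> is stated.\<close>
    also have "(LINT s|?I. exp (- \<eta> * t) * (M * L') * \<psi> s)
        = exp (- \<eta> * t) * (M * L' * integral {0..t} \<psi>)"
      using lebesgue_integral_eq_integral[OF \<psi>_int] by (simp add: mult.assoc)
    also have "norm (S t (x\<^sub>0\<^sub>1 - x\<^sub>0\<^sub>2)) \<le> M * exp (- \<eta> * t) * norm (x\<^sub>0\<^sub>1 - x\<^sub>0\<^sub>2)"
      using t by (intro S_decay) simp
    finally have "norm (x\<^sub>1 t - x\<^sub>2 t)
        \<le> exp (- \<eta> * t) * (M * norm (x\<^sub>0\<^sub>1 - x\<^sub>0\<^sub>2) + M * L' * integral {0..t} \<psi>)"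
      by (simp add: algebra_simps)
    then show ?thesis
      by (simp add: \<psi>_def exp_minus field_simps)
  qed
  show ?thesis
  proof
    fix t assume t: "t \<in> {0..T}"
    have "\<psi> t \<le> M * norm (x\<^sub>0\<^sub>1 - x\<^sub>0\<^sub>2) * exp (M * L' * t)"
      by (rule gronwall[OF \<psi>_cont rate_nonneg \<psi>_le t])
    \<comment> \<open>Dividing by the weight \<open>exp (\<eta> * t)\<close> turns Gronwall's growth
      at rate \<open>M * L'\<close> into decay at rate \<open>\<eta> - M * L'\<close>.\<close>
    then have "norm (x\<^sub>1 t - x\<^sub>2 t) \<le> M * norm (x\<^sub>0\<^sub>1 - x\<^sub>0\<^sub>2) * (exp (M * L' * t) / exp (\<eta> * t))"
      by (simp add: \<psi>_def field_simps)
    also have "exp (M * L' * t) / exp (\<eta> * t) = exp (- (\<eta> - M * L') * t)"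
      by (simp add: exp_diff[symmetric] algebra_simps)
    finally have x: "norm (x\<^sub>1 t - x\<^sub>2 t) \<le> M * exp (- (\<eta> - M * L') * t) * norm (x\<^sub>0\<^sub>1 - x\<^sub>0\<^sub>2)"
      by (simp only: mult_ac)
    moreover have "norm (u\<^sub>1 t - u\<^sub>2 t) \<le> L * M * exp (- (\<eta> - M * L') * t) * norm (x\<^sub>0\<^sub>1 - x\<^sub>0\<^sub>2)"
      using order_trans[OF u_le[OF t] mult_left_mono[OF x L_nonneg]] by (simp only: mult.assoc)
    ultimately show "norm (x\<^sub>1 t - x\<^sub>2 t) \<le> M * exp (- (\<eta> - M * L') * t) * norm (x\<^sub>0\<^sub>1 - x\<^sub>0\<^sub>2) \<and>
        norm (u\<^sub>1 t - u\<^sub>2 t) \<le> L * M * exp (- (\<eta> - M * L') * t) * norm (x\<^sub>0\<^sub>1 - x\<^sub>0\<^sub>2)"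
      by blast
  qed
qed

end
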